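(* For all $P \subseteq \mathbb{R}^2$, $\operatorname{opx}(n, P)$ is super-additive, i.e. $\operatorname{opx}(m+n, P) \ge \operatorname{opx}(m, P) + \operatorname{opx}(n, P)$ for all real $m, n > 0$.
   Context: Containment for subsets of the plane: for $P, S \subseteq \mathbb{R}^2$, let $X_P, Y_P$ be the sets of $x$-coordinates and $y$-coordinates of points of $P$, and $X_S, Y_S$ likewise for $S$. $S$ contains $P$ if there exist functions $f_X: X_P \to X_S$ and $f_Y: Y_P \to Y_S$ such that (1) $\frac{f_X(x_0)-f_X(x_1)}{x_0-x_1} \ge 1$ for all $x_0 > x_1$ in $X_P$; (2) $\frac{f_Y(y_0)-f_Y(y_1)}{y_0-y_1} \ge 1$ for all $y_0 > y_1$ in $Y_P$; (3) $(f_X(x), f_Y(y)) \in S$ for all $(x,y) \in P$. Otherwise $S$ is $P$-free. For real $n > 0$, $\operatorname{opx}(n,P)$ is the supremum of the Lebesgue measure $\mu_2(S)$ over all open $P$-free subsets $S \subseteq [0,n]^2$. *)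

theory Defs
  imports "HOL-Analysis.Analysis"
begin

(* Values of f and g outside fst ` P and snd ` P are irrelevant. *)
definition contains :: "(real \<times> real) set \<Rightarrow> (real \<times> real) set \<Rightarrow> bool" where
  "contains S P \<longleftrightarrow>
    (\<exists>f \<in> fst ` P \<rightarrow> fst ` S. \<exists>g \<in> snd ` P \<rightarrow> snd ` S.
      (\<forall>x0 \<in> fst ` P. \<forall>x1 \<in> fst ` P. x0 > x1 \<longrightarrow> (f x0 - f x1) / (x0 - x1) \<ge> 1) \<and>
      (\<forall>y0 \<in> snd ` P. \<forall>y1 \<in> snd ` P. y0 > y1 \<longrightarrow> (g y0 - g y1) / (y0 - y1) \<ge> 1) \<and>
      (\<forall>(x, y) \<in> P. (f x, g y) \<in> S))"

definition pattern_free :: "(real \<times> real) set \<Rightarrow> (real \<times> real) set \<Rightarrow> bool" where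
  "pattern_free P S \<longleftrightarrow> \<not> contains S P"

(* Every set contains the empty pattern, so opx n {} is a supremum over the empty family;
   in the extended nonnegative reals this is 0. For nonempty P the empty set is P-free. *)
definition opx :: "real \<Rightarrow> (real \<times> real) set \<Rightarrow> ennreal" where
  "opx n P = (SUP S \<in> {S. open S \<and> S \<subseteq> {0..n} \<times> {0..n} \<and> pattern_free P S}. emeasure lebesgue S)"

end

theory Submission
  imports Defs
begin

text \<open>
  Translate \<open>P\<close>-free open sets \<open>S \<subseteq> [0,m]\<^sup>2\<close> and \<open>T \<subseteq> [0,n]\<^sup>2\<close> into two diagonal blocks, or into
  two antidiagonal blocks, of \<open>[0,m+n]\<^sup>2\<close>. If both unions contained \<open>P\<close>, then \<open>P\<close> would split into
  two nonempty parts, one strictly to the lower left of the other, and also into two nonempty parts,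
  one strictly to the upper left of the other. Take a point from each part of the second splitting.
  They lie in the same part of the first, so a point in its other part dominates both of them or is
  dominated by both, and hence belongs to neither part of the second splitting.
\<close>

lemma containsI:
  assumes "\<And>x0 x1. \<lbrakk>x0 \<in> fst ` P; x1 \<in> fst ` P; x0 > x1\<rbrakk> \<Longrightarrow> (f x0 - f x1) / (x0 - x1) \<ge> 1"
    and "\<And>y0 y1. \<lbrakk>y0 \<in> snd ` P; y1 \<in> snd ` P; y0 > y1\<rbrakk> \<Longrightarrow> (g y0 - g y1) / (y0 - y1) \<ge> 1"
    and S: "\<And>x y. (x, y) \<in> P \<Longrightarrow> (f x, g y) \<in> S"
  shows "contains S P"
proof -
  have "f \<in> fst ` P \<rightarrow> fst ` S" "g \<in> snd ` P \<rightarrow> snd ` S"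
    using S by (force intro: rev_image_eqI)+
  with assms show ?thesis
    unfolding contains_def by blast
qed

lemma containsE:
  assumes "contains S P"
  obtains f g where
    "\<And>x0 x1. \<lbrakk>x0 \<in> fst ` P; x1 \<in> fst ` P; x0 > x1\<rbrakk> \<Longrightarrow> (f x0 - f x1) / (x0 - x1) \<ge> 1"
    "\<And>y0 y1. \<lbrakk>y0 \<in> snd ` P; y1 \<in> snd ` P; y0 > y1\<rbrakk> \<Longrightarrow> (g y0 - g y1) / (y0 - y1) \<ge> 1"
    "\<And>x y. (x, y) \<in> P \<Longrightarrow> (f x, g y) \<in> S"
proof -
  obtain f g where
    "\<forall>x0\<in>fst ` P. \<forall>x1\<in>fst ` P. x0 > x1 \<longrightarrow> (f x0 - f x1) / (x0 - x1) \<ge> 1"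
    "\<forall>y0\<in>snd ` P. \<forall>y1\<in>snd ` P. y0 > y1 \<longrightarrow> (g y0 - g y1) / (y0 - y1) \<ge> 1"
    "\<forall>(x, y)\<in>P. (f x, g y) \<in> S"
    using assms unfolding contains_def by (elim bexE conjE)
  then show thesis
    using that[of f g] by fast
qed

text \<open>Subtracting the constants \<open>fst v\<close> and \<open>snd v\<close> from the two
  coordinate maps leaves all difference quotients unchanged. Hence translates of
  \<open>P\<close>-free sets are \<open>P\<close>-free.\<close>

lemma contains_translation:
  assumes "contains ((+) v ` S) P"
  shows "contains S P"
  using assms
proof (rule containsE)
  fix f g
  assume "\<And>x0 x1. \<lbrakk>x0 \<in> fst ` P; x1 \<in> fst ` P; x0 > x1\<rbrakk> \<Longrightarrow> (f x0 - f x1) / (x0 - x1) \<ge> 1"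
    and "\<And>y0 y1. \<lbrakk>y0 \<in> snd ` P; y1 \<in> snd ` P; y0 > y1\<rbrakk> \<Longrightarrow> (g y0 - g y1) / (y0 - y1) \<ge> 1"
    and "\<And>x y. (x, y) \<in> P \<Longrightarrow> (f x, g y) \<in> (+) v ` S"
  moreover have "(x - fst v, y - snd v) \<in> S" if "(x, y) \<in> (+) v ` S" for x y
    using that by (cases v) auto
  ultimately show ?thesis
    by (intro containsI[where f = "\<lambda>x. f x - fst v" and g = "\<lambda>y. g y - snd v"]) simp_all
qed

text \<open>Slopes at least 1 make \<open>f\<close> and \<open>g\<close> strictly increasing, so
  strict order between images pulls back to \<open>P\<close>. Neither \<open>A\<close> nor
  \<open>B\<close> alone can hold the whole image of \<open>P\<close>, so each of them receives a
  point.\<close>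

lemma contains_Un_splits:
  assumes "contains (A \<union> B) P" "pattern_free P A" "pattern_free P B"
  obtains f g p q where
    "\<And>x x'. \<lbrakk>x \<in> fst ` P; x' \<in> fst ` P; f x < f x'\<rbrakk> \<Longrightarrow> x < x'"
    "\<And>y y'. \<lbrakk>y \<in> snd ` P; y' \<in> snd ` P; g y < g y'\<rbrakk> \<Longrightarrow> y < y'"
    "\<And>r. r \<in> P \<Longrightarrow> map_prod f g r \<in> A \<union> B"
    "p \<in> P" "map_prod f g p \<in> A" "q \<in> P" "map_prod f g q \<in> B"
  using assms(1)
proof (rule containsE)
  fix f g
  assume f: "\<And>x0 x1. \<lbrakk>x0 \<in> fst ` P; x1 \<in> fst ` P; x0 > x1\<rbrakk> \<Longrightarrow> (f x0 - f x1) / (x0 - x1) \<ge> 1"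
    and g: "\<And>y0 y1. \<lbrakk>y0 \<in> snd ` P; y1 \<in> snd ` P; y0 > y1\<rbrakk> \<Longrightarrow> (g y0 - g y1) / (y0 - y1) \<ge> 1"
    and AB: "\<And>x y. (x, y) \<in> P \<Longrightarrow> (f x, g y) \<in> A \<union> B"
  have escape: "\<exists>r\<in>P. map_prod f g r \<notin> S" if "pattern_free P S" for S
  proof (rule ccontr)
    assume "\<not> ?thesis"
    then have "(f x, g y) \<in> S" if "(x, y) \<in> P" for x y
      using that by force
    then have "contains S P"
      using f g by (intro containsI[of P f g])
    with \<open>pattern_free P S\<close> show False
      by (simp add: pattern_free_def)
  qed
  \<comment> \<open>The roles cross over: the point that escapes \<open>B\<close> lands in
    \<open>A\<close>, and the one that escapes \<open>A\<close> lands in \<open>B\<close>.\<close>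
  obtain p q where "p \<in> P" "map_prod f g p \<in> A" "q \<in> P" "map_prod f g q \<in> B"
    using AB escape[OF assms(2)] escape[OF assms(3)] by fastforce
  moreover have "x < x'" if "x \<in> fst ` P" "x' \<in> fst ` P" "f x < f x'" for x x'
    using f[of x x'] that by (cases x x' rule: linorder_cases) (auto simp: field_simps)
  moreover have "y < y'" if "y \<in> snd ` P" "y' \<in> snd ` P" "g y < g y'" for y y'
    using g[of y y'] that by (cases y y' rule: linorder_cases) (auto simp: field_simps)
  moreover have "map_prod f g r \<in> A \<union> B" if "r \<in> P" for r
    using AB that by (cases r) auto
  ultimately show thesis
    using that by blast
qed

text \<open>\<open>D r\<close> stands for "the image of \<open>r\<close> lies in \<open>A\<close>".
  Passing to a predicate on \<open>P\<close> forgets \<open>f\<close> and \<open>g\<close>, so that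
  splittings arising from different embeddings can be compared.\<close>

lemma diagonal_splits:
  assumes "contains (A \<union> B) P" "pattern_free P A" "pattern_free P B"
    and "A \<subseteq> {..<a} \<times> {..<b}" "B \<subseteq> {a<..} \<times> {b<..}"
  obtains D p q where "p \<in> P" "q \<in> P" "D p" "\<not> D q"
    "\<And>r s. \<lbrakk>r \<in> P; s \<in> P; D r; \<not> D s\<rbrakk> \<Longrightarrow> fst r < fst s \<and> snd r < snd s"
  using assms(1-3)
proof (rule contains_Un_splits)
  fix f g p q
  assume mono: "\<And>x x'. \<lbrakk>x \<in> fst ` P; x' \<in> fst ` P; f x < f x'\<rbrakk> \<Longrightarrow> x < x'"
    "\<And>y y'. \<lbrakk>y \<in> snd ` P; y' \<in> snd ` P; g y < g y'\<rbrakk> \<Longrightarrow> y < y'"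
    and AB: "\<And>r. r \<in> P \<Longrightarrow> map_prod f g r \<in> A \<union> B"
    and "p \<in> P" "map_prod f g p \<in> A" "q \<in> P" "map_prod f g q \<in> B"
  moreover have "fst r < fst s \<and> snd r < snd s"
    if "r \<in> P" "s \<in> P" "map_prod f g r \<in> A" "map_prod f g s \<notin> A" for r s
  proof -
    have "map_prod f g r \<in> {..<a} \<times> {..<b}" "map_prod f g s \<in> {a<..} \<times> {b<..}"
      using AB[OF that(2)] that(3,4) assms(4,5) by blast+
    then have "f (fst r) < f (fst s)" "g (snd r) < g (snd s)"
      by (auto simp: mem_Times_iff)
    then show ?thesis
      using mono that(1,2) by simp
  qed
  moreover have "A \<inter> B = {}"
    using assms(4,5) by fastforce
  ultimately show thesis
    using that[of p q "\<lambda>r. map_prod f g r \<in> A"] by blast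
qed

text \<open>The same argument with the second coordinate reversed; \<open>D\<close> now marks the
  upper left part.\<close>

lemma antidiagonal_splits:
  assumes "contains (A \<union> B) P" "pattern_free P A" "pattern_free P B"
    and "A \<subseteq> {..<a} \<times> {b<..}" "B \<subseteq> {a<..} \<times> {..<b}"
  obtains D p q where "p \<in> P" "q \<in> P" "D p" "\<not> D q"
    "\<And>r s. \<lbrakk>r \<in> P; s \<in> P; D r; \<not> D s\<rbrakk> \<Longrightarrow> fst r < fst s \<and> snd s < snd r"
  using assms(1-3)
proof (rule contains_Un_splits)
  fix f g p q
  assume mono: "\<And>x x'. \<lbrakk>x \<in> fst ` P; x' \<in> fst ` P; f x < f x'\<rbrakk> \<Longrightarrow> x < x'"
    "\<And>y y'. \<lbrakk>y \<in> snd ` P; y' \<in> snd ` P; g y < g y'\<rbrakk> \<Longrightarrow> y < y'"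
    and AB: "\<And>r. r \<in> P \<Longrightarrow> map_prod f g r \<in> A \<union> B"
    and "p \<in> P" "map_prod f g p \<in> A" "q \<in> P" "map_prod f g q \<in> B"
  moreover have "fst r < fst s \<and> snd s < snd r"
    if "r \<in> P" "s \<in> P" "map_prod f g r \<in> A" "map_prod f g s \<notin> A" for r s
  proof -
    have "map_prod f g r \<in> {..<a} \<times> {b<..}" "map_prod f g s \<in> {a<..} \<times> {..<b}"
      using AB[OF that(2)] that(3,4) assms(4,5) by blast+
    then have "f (fst r) < f (fst s)" "g (snd s) < g (snd r)"
      by (auto simp: mem_Times_iff)
    then show ?thesis
      using mono that(1,2) by simp
  qed
  moreover have "A \<inter> B = {}"
    using assms(4,5) by fastforce
  ultimately show thesis
    using that[of p q "\<lambda>r. map_prod f g r \<in> A"] by blast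
qed

lemma pattern_free_diagonal_or_antidiagonal:
  assumes free: "pattern_free P A" "pattern_free P B" "pattern_free P A'" "pattern_free P B'"
    and diag: "A \<subseteq> {..<a} \<times> {..<b}" "B \<subseteq> {a<..} \<times> {b<..}"
    and anti: "A' \<subseteq> {..<a'} \<times> {b'<..}" "B' \<subseteq> {a'<..} \<times> {..<b'}"
  shows "pattern_free P (A \<union> B) \<or> pattern_free P (A' \<union> B')"
proof (rule ccontr)
  assume "\<not> ?thesis"
  then have AB: "contains (A \<union> B) P" and AB': "contains (A' \<union> B') P"
    by (auto simp: pattern_free_def)
  obtain D p q where D: "p \<in> P" "q \<in> P" "D p" "\<not> D q"
    and D_less: "\<And>r s. \<lbrakk>r \<in> P; s \<in> P; D r; \<not> D s\<rbrakk> \<Longrightarrow> fst r < fst s \<and> snd r < snd s"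
    by (rule diagonal_splits[OF AB free(1,2) diag]) (rule that)
  obtain E p' q' where E: "p' \<in> P" "q' \<in> P" "E p'" "\<not> E q'"
    and E_less: "\<And>r s. \<lbrakk>r \<in> P; s \<in> P; E r; \<not> E s\<rbrakk> \<Longrightarrow> fst r < fst s \<and> snd s < snd r"
    by (rule antidiagonal_splits[OF AB' free(3,4) anti]) (rule that)
  \<comment> \<open>If \<open>D\<close> separated \<open>p'\<close> from \<open>q'\<close>, their
    two coordinates would be ordered the same way, whereas \<open>E\<close> orders them in opposite
    ways.\<close>
  have "D p' = D q'"
    using D_less[of p' q'] D_less[of q' p'] E_less[of p' q'] E by fastforce
  \<comment> \<open>If \<open>D\<close> holds at \<open>p'\<close> and \<open>q'\<close>, then
    \<open>q\<close> exceeds both in both coordinates: \<open>E q\<close> contradicts the comparison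
    with \<open>q'\<close>, and \<open>\<not> E q\<close> the one with \<open>p'\<close>. Otherwise
    \<open>p\<close> lies below both and the same contradictions arise, with \<open>p'\<close> and
    \<open>q'\<close> exchanged.\<close>
  then show False
    using D_less[of p' q] D_less[of q' q] E_less[of q q'] E_less[of p' q]
      D_less[of p p'] D_less[of p q'] E_less[of p q'] E_less[of p' p] D E
    by (smt (verit))
qed

text \<open>An open subset lies in the interior of the closed square. This gives the strict
  inequalities that separate two blocks sharing a corner.\<close>

lemma open_subset_square:
  fixes S :: "(real \<times> real) set"
  assumes "open S" "S \<subseteq> {0..n} \<times> {0..n}"
  shows "S \<subseteq> {0<..<n} \<times> {0<..<n}"
  using interior_maximal[OF assms(2,1)] unfolding interior_Times interior_atLeastAtMost_real .

lemma emeasure_lebesgue_translation: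
  fixes S :: "'a::euclidean_space set"
  shows "emeasure lebesgue ((+) v ` S) = emeasure lebesgue S"
proof -
  have "(+) v = (\<lambda>x. 1 *\<^sub>R x + v)"
    by (simp add: fun_eq_iff add.commute)
  then show ?thesis
    using emeasure_lebesgue_affine[of 1 v S] by simp
qed

lemma opx_upper:
  assumes "open S" "S \<subseteq> {0..n} \<times> {0..n}" "pattern_free P S"
  shows "emeasure lebesgue S \<le> opx n P"
  unfolding opx_def using assms by (intro SUP_upper) auto

lemma emeasure_add_le_opx:
  assumes "m > 0" "n > 0"
    and S: "open S" "S \<subseteq> {0..m} \<times> {0..m}" "pattern_free P S"
    and T: "open T" "T \<subseteq> {0..n} \<times> {0..n}" "pattern_free P T"
  shows "emeasure lebesgue S + emeasure lebesgue T \<le> opx (m + n) P"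
proof -
  \<comment> \<open>The measure estimate is the same for both placements, so it is proved for
    arbitrary translation vectors \<open>v\<close> and \<open>w\<close>.\<close>
  have block: "emeasure lebesgue S + emeasure lebesgue T \<le> opx (m + n) P"
    if free: "pattern_free P ((+) v ` S \<union> (+) w ` T)"
      and square: "(+) v ` S \<union> (+) w ` T \<subseteq> {0..m + n} \<times> {0..m + n}"
      and disj: "(+) v ` S \<inter> (+) w ` T = {}" for v w
  proof -
    have op: "open ((+) v ` S)" "open ((+) w ` T)"
      using S T by (auto intro: open_translation)
    have "emeasure lebesgue S + emeasure lebesgue T
        = emeasure lebesgue ((+) v ` S) + emeasure lebesgue ((+) w ` T)"
      by (simp add: emeasure_lebesgue_translation)
    also have "\<dots> = emeasure lebesgue ((+) v ` S \<union> (+) w ` T)"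
      using op disj by (intro plus_emeasure) auto
    also have "\<dots> \<le> opx (m + n) P"
      using op free square by (intro opx_upper) auto
    finally show ?thesis .
  qed
  have S': "S \<subseteq> {0<..<m} \<times> {0<..<m}" and T': "T \<subseteq> {0<..<n} \<times> {0<..<n}"
    using S T by (auto dest: open_subset_square)
  have free: "pattern_free P ((+) v ` S)" "pattern_free P ((+) v ` T)" for v
    using S T contains_translation unfolding pattern_free_def by blast+
  \<comment> \<open>The diagonal blocks meet at the corner \<open>(m, m)\<close>, the antidiagonal
    ones at \<open>(m, n)\<close>; these are the separating points.\<close>
  have "pattern_free P ((+) (0, 0) ` S \<union> (+) (m, m) ` T) \<or>
        pattern_free P ((+) (0, n) ` S \<union> (+) (m, 0) ` T)"
    by (rule pattern_free_diagonal_or_antidiagonal[where a = m and b = m and a' = m and b' = n])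
      (use free S' T' in auto)
  then show ?thesis
  proof
    assume "pattern_free P ((+) (0, 0) ` S \<union> (+) (m, m) ` T)"
    then show ?thesis
      by (rule block) (use S' T' assms(1,2) in fastforce)+
  next
    assume "pattern_free P ((+) (0, n) ` S \<union> (+) (m, 0) ` T)"
    then show ?thesis
      by (rule block) (use S' T' assms(1,2) in fastforce)+
  qed
qed

theorem lemma2p5:
  fixes P :: "(real \<times> real) set" and m n :: real
  assumes "m > 0" and "n > 0"
  shows "opx (m + n) P \<ge> opx m P + opx n P"
proof (cases "P = {}")
  case True
  then have "pattern_free P S \<longleftrightarrow> False" for S
    by (auto simp: pattern_free_def intro: containsI)
  then show ?thesis
    by (simp add: opx_def bot_ennreal)
next
  case False
  define F where "F k = {S. open S \<and> S \<subseteq> {0..k} \<times> {0..k} \<and> pattern_free P S}" for k :: real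
  \<comment> \<open>In \<open>ennreal\<close> an empty supremum is 0, so adding a constant commutes
    with a supremum in general only over a nonempty family.\<close>
  have F: "F k \<noteq> {}" for k
  proof -
    have "{} \<in> F k"
      using False by (auto simp: F_def pattern_free_def contains_def)
    then show ?thesis
      by blast
  qed
  have opx: "opx k P = (SUP S\<in>F k. emeasure lebesgue S)" for k
    by (simp add: opx_def F_def)
  have "opx m P + opx n P = (SUP T\<in>F n. SUP S\<in>F m. emeasure lebesgue S + emeasure lebesgue T)"
    by (simp add: opx F ennreal_SUP_add_left ennreal_SUP_add_right)
  also have "\<dots> \<le> opx (m + n) P"
    using emeasure_add_le_opx[OF assms] by (intro SUP_least) (auto simp: F_def)
  finally show ?thesis .
qed

end
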